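(* Let $L=\bigoplus_{n\in\mathbb{Z}}L_n$ be a finite-dimensional $\mathbb{Z}$-graded Lie algebra over a field of prime characteristic and let $M$ be a finite-dimensional indecomposable $L$-module. Set $L^{+}:=\bigoplus_{n>0}L_n$ and $L^{-}:=\bigoplus_{n<0}L_n$. If there exists an element $x\in L^{+}\cup L^{-}$ such that $(x)_M$ is not nilpotent, then $H^n(L,M)=0$ for every non-negative integer $n$.
   Context: $(x)_M$ denotes the linear endomorphism of $M$ given by the action of $x\in L$. $H^n(L,M)$ denotes ordinary (Chevalley-Eilenberg) Lie algebra cohomology. The module $M$ is not assumed to be graded. *)

theory Defs
  imports Complex_Main "HOL-Computational_Algebra.Primes"
begin

locale lie_algebra = vector_space scale
  for scale :: "'k::field \<Rightarrow> 'l::ab_group_add \<Rightarrow> 'l" (infixr "*\<^sub>L" 75) +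
  fixes bracket :: "'l \<Rightarrow> 'l \<Rightarrow> 'l"
  assumes bracket_linear_right: "Vector_Spaces.linear scale scale (\<lambda>y. bracket x y)"
    and bracket_linear_left: "Vector_Spaces.linear scale scale (\<lambda>x. bracket x y)"
    and bracket_self: "bracket x x = 0"
    and jacobi: "bracket x (bracket y z) + bracket y (bracket z x) + bracket z (bracket x y) = 0"

locale graded_lie_algebra = lie_algebra scale bracket
  for scale :: "'k::field \<Rightarrow> 'l::ab_group_add \<Rightarrow> 'l" (infixr "*\<^sub>L" 75)
    and bracket :: "'l \<Rightarrow> 'l \<Rightarrow> 'l" +
  fixes G :: "int \<Rightarrow> 'l set"
  assumes subspace_component: "subspace (G i)"
    and direct_sum: "\<exists>!f. (\<forall>i. f i \<in> G i) \<and> finite {i. f i \<noteq> 0} \<and> x = (\<Sum>i | f i \<noteq> 0. f i)"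
    and bracket_component: "a \<in> G i \<Longrightarrow> b \<in> G j \<Longrightarrow> bracket a b \<in> G (i + j)"
begin

text \<open>
  The sum of a family of subspaces is the span of their union; the sums below are direct because
  \<open>G\<close> is independent.
\<close>

definition positive_part :: "'l set" where
  "positive_part = span (\<Union>i\<in>{0<..}. G i)"

definition negative_part :: "'l set" where
  "negative_part = span (\<Union>i\<in>{..<0}. G i)"

end

locale lie_module = lie_algebra scaleL bracket + M: vector_space scaleM
  for scaleL :: "'k::field \<Rightarrow> 'l::ab_group_add \<Rightarrow> 'l" (infixr "*\<^sub>L" 75)
    and bracket :: "'l \<Rightarrow> 'l \<Rightarrow> 'l"
    and scaleM :: "'k \<Rightarrow> 'm::ab_group_add \<Rightarrow> 'm" (infixr "*\<^sub>M" 75) +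
  fixes act :: "'l \<Rightarrow> 'm \<Rightarrow> 'm"
  assumes act_linear_right: "Vector_Spaces.linear scaleM scaleM (\<lambda>m. act x m)"
    and act_linear_left: "Vector_Spaces.linear scaleL scaleM (\<lambda>x. act x m)"
    and act_bracket: "act (bracket x y) m = act x (act y m) - act y (act x m)"
begin

definition submodule :: "'m set \<Rightarrow> bool" where
  "submodule U \<longleftrightarrow> M.subspace U \<and> (\<forall>x. \<forall>u\<in>U. act x u \<in> U)"

definition indecomposable :: bool where
  "indecomposable \<longleftrightarrow>
     (UNIV :: 'm set) \<noteq> {0} \<and>
     (\<forall>U V. submodule U \<and> submodule V \<and> U \<inter> V = {0} \<and> {u + v | u v. u \<in> U \<and> v \<in> V} = UNIV
        \<longrightarrow> U = {0} \<or> V = {0})"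

text \<open>
  An \<open>n\<close>-cochain is an alternating \<open>n\<close>-linear map from \<open>L\<close> to \<open>M\<close>. It is encoded as a function on
  lists of length \<open>n\<close>, set to \<open>0\<close> on all other lists, so that the encoding is unique.
\<close>

definition cochains :: "nat \<Rightarrow> ('l list \<Rightarrow> 'm) set" where
  "cochains n = {f.
     (\<forall>xs. length xs \<noteq> n \<longrightarrow> f xs = 0) \<and>
     (\<forall>xs i. length xs = n \<and> i < n \<longrightarrow> Vector_Spaces.linear scaleL scaleM (\<lambda>x. f (xs[i := x]))) \<and>
     (\<forall>xs. length xs = n \<and> \<not> distinct xs \<longrightarrow> f xs = 0)}"

text \<open>
  The Chevalley--Eilenberg differential, with arguments indexed from \<open>0\<close>; \<open>nths xs (- I)\<close> omits
  the entries with indices in \<open>I\<close>. The formula does not mention the degree: if \<open>f\<close> vanishes on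
  lists of length different from \<open>n\<close>, then \<open>differential f\<close> vanishes on lists of length different
  from \<open>n + 1\<close>.
\<close>

definition differential :: "('l list \<Rightarrow> 'm) \<Rightarrow> 'l list \<Rightarrow> 'm" where
  "differential f xs =
     (\<Sum>i<length xs. (-1) ^ i *\<^sub>M act (xs ! i) (f (nths xs (- {i})))) +
     (\<Sum>j<length xs. \<Sum>i<j.
        (-1) ^ (i + j) *\<^sub>M f (bracket (xs ! i) (xs ! j) # nths xs (- {i, j})))"

definition cocycles :: "nat \<Rightarrow> ('l list \<Rightarrow> 'm) set" where
  "cocycles n = {f \<in> cochains n. differential f = (\<lambda>_. 0)}"

definition coboundaries :: "nat \<Rightarrow> ('l list \<Rightarrow> 'm) set" where
  "coboundaries n = (case n of 0 \<Rightarrow> {\<lambda>_. 0} | Suc m \<Rightarrow> differential ` cochains m)"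

definition cohomology_class :: "nat \<Rightarrow> ('l list \<Rightarrow> 'm) \<Rightarrow> ('l list \<Rightarrow> 'm) set" where
  "cohomology_class n f = {\<lambda>xs. f xs + b xs | b. b \<in> coboundaries n}"

definition cohomology :: "nat \<Rightarrow> ('l list \<Rightarrow> 'm) set set" where
  "cohomology n = cohomology_class n ` cocycles n"

end

definition nilpotent_map :: "('m \<Rightarrow> 'm::zero) \<Rightarrow> bool" where
  "nilpotent_map f \<longleftrightarrow> (\<exists>k. f ^^ k = (\<lambda>_. 0))"

definition finite_dimensional :: "('k::field \<Rightarrow> 'v::ab_group_add \<Rightarrow> 'v) \<Rightarrow> bool" where
  "finite_dimensional scale \<longleftrightarrow> (\<exists>B. finite_dimensional_vector_space scale B)"

end

theory Submission
  imports Defs "HOL-Library.Function_Algebras"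
begin

text \<open>
  Since \<open>x\<close> lies in \<open>L\<^sup>+\<close> or \<open>L\<^sup>-\<close>, the map \<open>ad x\<close> is nilpotent, so \<open>(ad x)\<^sup>q = 0\<close> for a large power
  \<open>q\<close> of the characteristic. Raising to the power \<open>q\<close> turns commutators with \<open>x\<close> into the action
  of \<open>(ad x)\<^sup>q\<close>. Hence \<open>\<phi> = (x)\<^sub>M\<^sup>q\<close> is an endomorphism of the module \<open>M\<close>; it is not nilpotent, so it is
  bijective by Fitting's lemma and indecomposability. For the same reason the \<open>q\<close>-th power of the
  Lie derivative \<open>\<theta>\<close> of \<open>x\<close> on cochains is composition with \<open>\<phi>\<close>. By Cartan's formula
  \<open>\<theta> f = d (i f)\<close> for a cocycle \<open>f\<close>, with \<open>i\<close> the contraction by \<open>x\<close>; as \<open>\<theta>\<close> commutes with \<open>d\<close>,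
  we get \<open>\<phi> \<circ> f = \<theta>\<^sup>q f = d (\<theta>\<^sup>q\<^sup>-\<^sup>1 (i f))\<close>, so \<open>f\<close> is the coboundary of \<open>\<phi>\<^sup>-\<^sup>1 \<circ> \<theta>\<^sup>q\<^sup>-\<^sup>1 (i f)\<close>.
\<close>

section \<open>Iterates of linear maps\<close>

lemma linear_funpow:
  assumes "vector_space s" "Vector_Spaces.linear s s f"
  shows "Vector_Spaces.linear s s (f ^^ n)"
proof (induction n)
  case 0
  show ?case using vector_space.linear_id[OF assms(1)] by (simp add: id_def)
next
  case (Suc n)
  then show ?case using Vector_Spaces.linear_compose[OF Suc assms(2)] by (simp only: funpow.simps)
qed

section \<open>Powers of an operator and iterated commutators in prime characteristic\<close>

context vector_space
begin

text \<open>The hypothesis says that S k is the k-fold commutator of f with S 0. A sequence of maps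
  lets one lemma serve both for module actions and for contractions of cochains. The expansion
  follows by moving f past S one factor at a time, with Pascal's rule.\<close>

lemma funpow_commutator_Leibniz:
  assumes "Vector_Spaces.linear scale scale f"
    and comm: "\<And>k v. f (S k v) - S k (f v) = S (Suc k) v"
  shows "(f ^^ n) (S k v) = (\<Sum>j\<le>n. of_nat (n choose j) *s S (k + j) ((f ^^ (n - j)) v))"
proof (induction n)
  case (Suc n)
  interpret f: Vector_Spaces.linear scale scale f by fact
  let ?T = "\<lambda>j. S (k + j) ((f ^^ (Suc n - j)) v)"
  have step: "f (S i w) = S i (f w) + S (Suc i) w" for i w
    using comm[of i w] by (simp add: algebra_simps)
  have "(f ^^ Suc n) (S k v) =
      (\<Sum>j\<le>n. of_nat (n choose j) *s f (S (k + j) ((f ^^ (n - j)) v)))"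
    by (simp add: Suc f.sum f.scale)
  also have "\<dots> = (\<Sum>j\<le>n. of_nat (n choose j) *s ?T j + of_nat (n choose j) *s ?T (Suc j))"
    by (intro sum.cong refl) (simp add: step scale_right_distrib Suc_diff_le)
  \<comment> \<open>The new top term has coefficient \<open>n choose Suc n\<close>, which is zero.
    With it both sums can be aligned after splitting off index 0.\<close>
  also have "\<dots> = (\<Sum>j\<le>Suc n. of_nat (n choose j) *s ?T j) +
      (\<Sum>j\<le>n. of_nat (n choose j) *s ?T (Suc j))"
    by (simp add: sum.distrib binomial_eq_0)
  also have "\<dots> = ?T 0 + (\<Sum>j\<le>n. of_nat (Suc n choose Suc j) *s ?T (Suc j))"
    unfolding sum.atMost_Suc_shift
    by (simp add: sum.distrib[symmetric] scale_left_distrib algebra_simps)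
  also have "\<dots> = (\<Sum>j\<le>Suc n. of_nat (Suc n choose j) *s ?T j)"
    unfolding sum.atMost_Suc_shift by simp
  finally show ?case .
qed simp

text \<open>The characteristic p divides every binomial coefficient p over j with 0 < j < p, so only
  the two outer terms of the Leibniz expansion survive.\<close>

lemma funpow_char_commutator:
  assumes "prime CHAR('a)" "Vector_Spaces.linear scale scale f"
    and "\<And>k v. f (S k v) - S k (f v) = S (Suc k) v"
  shows "(f ^^ CHAR('a)) (S k v) - S k ((f ^^ CHAR('a)) v) = S (k + CHAR('a)) v"
proof -
  let ?p = "CHAR('a)"
  let ?t = "\<lambda>j. of_nat (?p choose j) *s S (k + j) ((f ^^ (?p - j)) v)"
  have p: "0 < ?p" using assms(1) prime_gt_0_nat by blast
  have "(f ^^ ?p) (S k v) = (\<Sum>j\<le>?p. ?t j)"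
    by (rule funpow_commutator_Leibniz) (use assms in auto)
  also have "\<dots> = (\<Sum>j\<in>{0, ?p}. ?t j)"
  proof (rule sum.mono_neutral_right)
    show "\<forall>j\<in>{..?p} - {0, ?p}. ?t j = 0"
    proof
      fix j assume "j \<in> {..?p} - {0, ?p}"
      then have "?p dvd (?p choose j)"
        using assms(1) by (intro dvd_choose_prime) auto
      then show "?t j = 0" by (simp add: of_nat_eq_0_iff_char_dvd)
    qed
  qed auto
  also have "\<dots> = S k ((f ^^ ?p) v) + S (k + ?p) v"
    using p by simp
  finally show ?thesis by simp
qed

text \<open>With q the current power of p, the map f^q satisfies the same commutator relation along
  the subsequence of step q. The case of exponent p therefore applies again and yields
  f^(pq).\<close>

lemma funpow_char_power_commutator:
  assumes "prime CHAR('a)" "Vector_Spaces.linear scale scale f"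
    and "\<And>k v. f (S k v) - S k (f v) = S (Suc k) v"
  shows "(f ^^ (CHAR('a) ^ m)) (S k v) - S k ((f ^^ (CHAR('a) ^ m)) v) = S (k + CHAR('a) ^ m) v"
proof (induction m arbitrary: k v)
  case 0
  show ?case using assms(3) by simp
next
  case (Suc m)
  let ?q = "CHAR('a) ^ m"
  \<comment> \<open>The indices stay unsimplified so that they match the subsequence
    \<open>\<lambda>j. S (k + j * ?q)\<close> at j = 0 and j = p.\<close>
  have "((f ^^ ?q) ^^ CHAR('a)) (S (k + 0 * ?q) v) - S (k + 0 * ?q) (((f ^^ ?q) ^^ CHAR('a)) v) =
      S (k + (0 + CHAR('a)) * ?q) v"
  proof (rule funpow_char_commutator[where S = "\<lambda>j. S (k + j * ?q)"])
    show "Vector_Spaces.linear scale scale (f ^^ ?q)"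
      using linear_funpow[OF vector_space_axioms assms(2)] .
    show "(f ^^ ?q) (S (k + j * ?q) w) - S (k + j * ?q) ((f ^^ ?q) w) = S (k + Suc j * ?q) w" for j w
      using Suc[of "k + j * ?q" w] by (simp add: algebra_simps)
  qed fact
  then show ?case by (simp add: funpow_mult mult.commute)
qed

end

section \<open>Stabilization of images and kernels of powers\<close>

context finite_dimensional_vector_space
begin

text \<open>Images of powers decrease and kernels increase, so both are constant from the point
  where their dimensions are extremal. Comparing N with N + N is what Fitting's decomposition
  needs.\<close>

lemma funpow_stable:
  assumes "Vector_Spaces.linear scale scale f"
  obtains N where "0 < N" "range (f ^^ (N + N)) = range (f ^^ N)"
    "{v. (f ^^ (N + N)) v = 0} = {v. (f ^^ N) v = 0}"
proof -
  let ?R = "\<lambda>n. range (f ^^ n)" and ?K = "\<lambda>n. {v. (f ^^ n) v = 0}"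
  have lin: "Vector_Spaces.linear scale scale (f ^^ n)" for n
    using linear_funpow[OF vector_space_axioms assms] .
  have subR: "subspace (?R n)" and subK: "subspace (?K n)" for n
  proof -
    interpret Vector_Spaces.linear scale scale "f ^^ n" by (rule lin)
    show "subspace (?R n)" "subspace (?K n)"
      using subspace_image[OF subspace_UNIV] subspace_kernel by auto
  qed
  have Rmono: "?R (m + n) \<subseteq> ?R m" for m n
    by (auto simp: funpow_add)
  have Kmono: "?K n \<subseteq> ?K (m + n)" for m n
  proof -
    interpret Vector_Spaces.linear scale scale "f ^^ m" by (rule lin)
    show ?thesis by (auto simp: funpow_add)
  qed
  obtain a where a: "\<And>n. dim (?R a) \<le> dim (?R n)"
    using ex_has_least_nat[of "\<lambda>_. True" 0 "\<lambda>n. dim (?R n)"] by auto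
  obtain b where b: "\<And>n. dim (?K n) \<le> dim (?K b)"
    using ex_has_greatest_nat[of "\<lambda>_. True" 0 "\<lambda>n. dim (?K n)" "Suc dimension"]
      dim_subset_UNIV
    by (auto simp: less_Suc_eq_le)
  \<comment> \<open>This exponent lies beyond both stabilization points, and the successor makes it
    positive.\<close>
  let ?N = "Suc (a + b)"
  have "?R (?N + ?N) = ?R ?N"
  proof (rule subspace_dim_equal[OF subR subR Rmono])
    have "dim (?R ?N) \<le> dim (?R a)"
      using dim_subset[OF Rmono[of a "Suc b"]] by simp
    then show "dim (?R ?N) \<le> dim (?R (?N + ?N))" using a order_trans by blast
  qed
  moreover have "?K ?N = ?K (?N + ?N)"
  proof (rule subspace_dim_equal[OF subK subK Kmono])
    have "dim (?K b) \<le> dim (?K ?N)"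
      using dim_subset[OF Kmono[of b "Suc a"]] by (simp add: add.commute)
    then show "dim (?K (?N + ?N)) \<le> dim (?K ?N)" using b order_trans by blast
  qed
  ultimately show thesis using that[of ?N] by auto
qed

end

section \<open>Nilpotency of the adjoint action\<close>

context lie_algebra
begin

lemma bracket_add_right: "bracket x (y + z) = bracket x y + bracket x z"
  and bracket_scale_right: "bracket x (c *\<^sub>L y) = c *\<^sub>L bracket x y"
  using bracket_linear_right[of x] by (simp_all add: Vector_Spaces.linear_iff)

lemma bracket_add_left: "bracket (x + y) z = bracket x z + bracket y z"
  and bracket_scale_left: "bracket (c *\<^sub>L x) z = c *\<^sub>L bracket x z"
  using bracket_linear_left[of z] by (simp_all add: Vector_Spaces.linear_iff)

lemma bracket_zero_right: "bracket x 0 = 0"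
  using bracket_add_right[of x 0 0] by simp

lemma bracket_zero_left: "bracket 0 x = 0"
  using bracket_add_left[of 0 0 x] by simp

lemma bracket_minus_right: "bracket x (- y) = - bracket x y"
  using bracket_add_right[of x y "- y"] by (simp add: bracket_zero_right eq_neg_iff_add_eq_0 add.commute)

lemma bracket_antisym: "bracket y x = - bracket x y"
proof -
  have "bracket x y + bracket y x = 0"
    using bracket_self[of "x + y"] unfolding bracket_add_left bracket_add_right
    by (simp add: bracket_self add.commute)
  then show ?thesis by (simp add: eq_neg_iff_add_eq_0 add.commute)
qed

lemma bracket_derivation:
  "bracket x (bracket y z) = bracket (bracket x y) z + bracket y (bracket x z)"
proof -
  have "bracket y (bracket z x) = - bracket y (bracket x z)"
    by (subst bracket_antisym) (rule bracket_minus_right)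
  moreover have "bracket z (bracket x y) = - bracket (bracket x y) z"
    by (rule bracket_antisym)
  ultimately have "bracket x (bracket y z) - bracket y (bracket x z) - bracket (bracket x y) z = 0"
    using jacobi[of x y z] by simp
  then show ?thesis by (simp add: algebra_simps)
qed

end

section \<open>Homogeneous components and the degree filtration\<close>

context graded_lie_algebra
begin

definition decomposes :: "'l \<Rightarrow> (int \<Rightarrow> 'l) \<Rightarrow> bool" where
  "decomposes x f \<longleftrightarrow> (\<forall>i. f i \<in> G i) \<and> finite {i. f i \<noteq> 0} \<and> x = (\<Sum>i | f i \<noteq> 0. f i)"

definition component :: "'l \<Rightarrow> int \<Rightarrow> 'l" where
  "component x = (THE f. decomposes x f)"

lemma decomposes_component: "decomposes x (component x)"
  unfolding component_def
  by (rule theI'[where P = "decomposes x"]) (unfold decomposes_def, rule direct_sum)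

lemma component_eqI: "decomposes x f \<Longrightarrow> component x = f"
  using direct_sum[of x] decomposes_component[of x] unfolding decomposes_def by blast

text \<open>Any finite index set containing the support is allowed, so that two vectors can be
  summed over a common set.\<close>

lemma decomposesI:
  assumes "\<And>i. f i \<in> G i" "finite A" "{i. f i \<noteq> 0} \<subseteq> A" "x = sum f A"
  shows "decomposes x f"
  unfolding decomposes_def
  using assms finite_subset[OF assms(3,2)] by (auto intro!: sum.mono_neutral_right)

lemma component_add: "component (x + y) = (\<lambda>i. component x i + component y i)"
proof (rule component_eqI, rule decomposesI)
  let ?A = "{i. component x i \<noteq> 0}" and ?B = "{i. component y i \<noteq> 0}"
  have x: "\<And>i. component x i \<in> G i" "finite ?A" "x = sum (component x) ?A"
    and y: "\<And>i. component y i \<in> G i" "finite ?B" "y = sum (component y) ?B"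
    using decomposes_component[of x] decomposes_component[of y] by (auto simp: decomposes_def)
  show "component x i + component y i \<in> G i" for i
    using x(1) y(1) subspace_add[OF subspace_component] by blast
  show "finite (?A \<union> ?B)" using x y by simp
  have "x = sum (component x) (?A \<union> ?B)"
    by (subst x(3)) (rule sum.mono_neutral_left, use x y in auto)
  moreover have "y = sum (component y) (?A \<union> ?B)"
    by (subst y(3)) (rule sum.mono_neutral_left, use x y in auto)
  ultimately show "x + y = (\<Sum>i\<in>?A \<union> ?B. component x i + component y i)"
    by (simp add: sum.distrib)
qed auto

lemma component_scale: "component (c *\<^sub>L x) = (\<lambda>i. c *\<^sub>L component x i)"
proof (rule component_eqI, rule decomposesI)
  let ?A = "{i. component x i \<noteq> 0}"
  have x: "\<And>i. component x i \<in> G i" "finite ?A" "x = sum (component x) ?A"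
    using decomposes_component[of x] by (auto simp: decomposes_def)
  show "c *\<^sub>L component x i \<in> G i" for i
    using x(1) subspace_scale[OF subspace_component] by blast
  show "c *\<^sub>L x = (\<Sum>i\<in>?A. c *\<^sub>L component x i)"
    by (subst x(3)) (simp add: scale_sum_right)
  show "finite ?A" by (rule x(2))
qed auto

lemma component_homogeneous:
  assumes "x \<in> G i"
  shows "component x = (\<lambda>j. if j = i then x else 0)"
  by (rule component_eqI, rule decomposesI[where A = "{i}"])
    (use assms subspace_0[OF subspace_component] in auto)

lemma linear_component: "Vector_Spaces.linear scale scale (\<lambda>x. component x i)"
  by (simp add: Vector_Spaces.linear_iff component_add component_scale vector_space_axioms)

text \<open>Taking components is linear, so the only degrees that occur are those of a finite
  basis.\<close>

lemma finite_support:
  assumes "finite_dimensional scale"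
  obtains K where "0 \<le> K" "\<And>x i. component x i \<noteq> 0 \<Longrightarrow> \<bar>i\<bar> \<le> K"
proof -
  obtain B where "finite_dimensional_vector_space scale B"
    using assms unfolding finite_dimensional_def by blast
  then interpret fd: finite_dimensional_vector_space scale B .
  let ?I = "\<Union>b\<in>B. {i. component b i \<noteq> 0}"
  have "finite ?I"
    using fd.finite_Basis decomposes_component by (auto simp: decomposes_def)
  then obtain K where K: "\<And>i. i \<in> ?I \<Longrightarrow> \<bar>i\<bar> \<le> K"
    using finite_imageI[of ?I abs] by (metis Max_ge imageI)
  have "component x i = 0" if "i \<notin> ?I" for x i
  proof -
    interpret c: Vector_Spaces.linear scale scale "\<lambda>x. component x i" by (rule linear_component)
    show ?thesis
      by (rule c.eq_0_on_span[where b = B]) (use that fd.span_Basis in auto)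
  qed
  \<comment> \<open>The maximum with 0 ensures a nonnegative bound.\<close>
  then show thesis
    using that[of "max K 0"] K by (metis max.cobounded2 max.coboundedI1)
qed

text \<open>The sign \<open>s = \<plusminus>1\<close> serves to treat the positive and the negative part at once.\<close>

definition filtration :: "int \<Rightarrow> int \<Rightarrow> 'l set" where
  "filtration s m = span (\<Union>i\<in>{i. m \<le> s * i}. G i)"

lemma bracket_filtration:
  assumes "x \<in> filtration s m" "y \<in> filtration s n"
  shows "bracket x y \<in> filtration s (m + n)"
  using assms(1) unfolding filtration_def
proof (induction rule: span_induct)
  case base
  show ?case
    by (auto intro!: subspaceI simp: bracket_zero_left bracket_add_left bracket_scale_left
        span_zero span_add span_scale)
next
  case (step a)
  then obtain i where i: "m \<le> s * i" "a \<in> G i" by auto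
  show ?case
    using assms(2) unfolding filtration_def
  proof (induction rule: span_induct)
    case base
    show ?case
      by (auto intro!: subspaceI simp: bracket_zero_right bracket_add_right bracket_scale_right
          span_zero span_add span_scale)
  next
    case (step b)
    then obtain j where j: "n \<le> s * j" "b \<in> G j" by auto
    have "m + n \<le> s * (i + j)" using i j by (simp add: algebra_simps)
    then show ?case
      using bracket_component[OF i(2) j(2)] by (intro span_base) blast
  qed
qed

text \<open>The degrees, taken with the sign s, lie between -K and K, and each application of ad x
  raises the filtration index by at least one. Every vector starts in index -K and is pushed past
  K.\<close>

lemma ad_nilpotent:
  assumes "finite_dimensional scale" "x \<in> positive_part \<union> negative_part"
  obtains N where "\<And>k y. N \<le> k \<Longrightarrow> (bracket x ^^ k) y = 0"
proof -
  have "\<exists>s. \<bar>s\<bar> = 1 \<and> x \<in> filtration s 1"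
  proof (cases "x \<in> positive_part")
    case True
    have "{0<..} = {i::int. 1 \<le> 1 * i}" by auto
    then show ?thesis
      using True unfolding positive_part_def filtration_def
      by (intro exI[of _ 1]) simp
  next
    case False
    have "{..<0} = {i::int. 1 \<le> (- 1) * i}" by auto
    then show ?thesis
      using False assms(2) unfolding negative_part_def filtration_def
      by (intro exI[of _ "- 1"]) simp
  qed
  then obtain s :: int where s: "\<bar>s\<bar> = 1" and x: "x \<in> filtration s 1" by blast
  obtain K where K: "0 \<le> K" "\<And>x i. component x i \<noteq> 0 \<Longrightarrow> \<bar>i\<bar> \<le> K"
    using finite_support[OF assms(1)] by blast
  have abs: "\<bar>s * i\<bar> = \<bar>i\<bar>" for i
    using s by (simp add: abs_mult)
  have all: "y \<in> filtration s (- K)" for y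
  proof -
    have y: "\<And>i. component y i \<in> G i" "y = (\<Sum>i | component y i \<noteq> 0. component y i)"
      using decomposes_component[of y] by (auto simp: decomposes_def)
    have "component y i \<in> filtration s (- K)" if "component y i \<noteq> 0" for i
    proof -
      have "- K \<le> s * i" using abs[of i] K(2)[OF that] by linarith
      then show ?thesis unfolding filtration_def using y(1) by (intro span_base) blast
    qed
    then show ?thesis
      by (subst y(2)) (auto intro!: span_sum simp: filtration_def)
  qed
  have zero: "y = 0" if y: "y \<in> filtration s m" and m: "K < m" for y m
  proof -
    have "(\<Union>i\<in>{i. m \<le> s * i}. G i) \<subseteq> {0}"
    proof
      fix g assume "g \<in> (\<Union>i\<in>{i. m \<le> s * i}. G i)"
      then obtain i where i: "m \<le> s * i" "g \<in> G i" by auto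
      then have "\<not> \<bar>i\<bar> \<le> K" using abs[of i] m by linarith
      then have "component g i = 0" using K(2) by blast
      then show "g \<in> {0}" using component_homogeneous[OF i(2)] by simp
    qed
    then have "span (\<Union>i\<in>{i. m \<le> s * i}. G i) \<subseteq> {0}"
      by (rule span_minimal) simp
    then show ?thesis using y by (auto simp: filtration_def)
  qed
  have pow: "(bracket x ^^ k) y \<in> filtration s (- K + int k)" for k y
  proof (induction k)
    case (Suc k)
    then show ?case using bracket_filtration[OF x Suc] by (simp add: algebra_simps)
  qed (simp add: all)
  show thesis
  proof (rule that)
    \<comment> \<open>The index after k steps is -K + k, and k = 2K + 1 is the first value that
      makes it exceed K.\<close>
    fix k y assume "nat (2 * K + 1) \<le> k"
    then have "K < - K + int k" using K(1) by linarith
    then show "(bracket x ^^ k) y = 0" using zero pow by blast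
  qed
qed

end

section \<open>Lie derivative and Cartan's formula\<close>

context lie_module
begin

section \<open>Alternating maps and contraction\<close>

lemma linearI:
  assumes "\<And>x y. f (x + y) = f x + f y" "\<And>c x. f (c *\<^sub>L x) = c *\<^sub>M f x"
  shows "Vector_Spaces.linear scaleL scaleM f"
  using assms by (simp add: Vector_Spaces.linear_iff vector_space_axioms M.vector_space_axioms)

lemma act_add_right: "act x (u + v) = act x u + act x v"
  and act_scale_right: "act x (c *\<^sub>M u) = c *\<^sub>M act x u"
  using act_linear_right[of x] by (simp_all add: Vector_Spaces.linear_iff)

lemma act_add_left: "act (x + y) u = act x u + act y u"
  using act_linear_left[of u] by (simp add: Vector_Spaces.linear_iff)

lemma act_zero_right: "act x 0 = 0"
  using act_add_right[of x 0 0] by simp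

lemma act_zero_left: "act 0 u = 0"
  using act_add_left[of 0 0 u] by simp

lemma act_diff_right: "act x (u - v) = act x u - act x v"
  using act_add_right[of x "u - v" v] by (simp add: algebra_simps)

text \<open>No degree is fixed, so that inductions on the argument list can replace f by its
  contractions without tracking n.\<close>

definition alternating :: "('l list \<Rightarrow> 'm) \<Rightarrow> bool" where
  "alternating f \<longleftrightarrow>
     (\<forall>xs i. i < length xs \<longrightarrow> Vector_Spaces.linear scaleL scaleM (\<lambda>x. f (xs[i := x]))) \<and>
     (\<forall>xs. \<not> distinct xs \<longrightarrow> f xs = 0)"

lemma alternating_add:
  "alternating f \<Longrightarrow> i < length xs \<Longrightarrow> f (xs[i := x + y]) = f (xs[i := x]) + f (xs[i := y])"
  and alternating_scale:
  "alternating f \<Longrightarrow> i < length xs \<Longrightarrow> f (xs[i := c *\<^sub>L x]) = c *\<^sub>M f (xs[i := x])"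
  by (simp_all add: alternating_def Vector_Spaces.linear_iff)

lemma alternating_nondistinct: "alternating f \<Longrightarrow> \<not> distinct xs \<Longrightarrow> f xs = 0"
  by (simp add: alternating_def)

text \<open>On lists of the wrong length a cochain is zero, hence linear in each slot; the degree
  becomes a mere support condition.\<close>

lemma cochains_iff:
  "f \<in> cochains n \<longleftrightarrow> alternating f \<and> (\<forall>xs. length xs \<noteq> n \<longrightarrow> f xs = 0)"
proof
  assume f: "f \<in> cochains n"
  have "Vector_Spaces.linear scaleL scaleM (\<lambda>x. f (xs[i := x]))" if "i < length xs" for xs i
  proof (cases "length xs = n")
    case False
    then have "f (xs[i := x]) = 0" for x using f by (simp add: cochains_def)
    then show ?thesis by (simp add: linearI)
  qed (use f that in \<open>auto simp: cochains_def\<close>)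
  then show "alternating f \<and> (\<forall>xs. length xs \<noteq> n \<longrightarrow> f xs = 0)"
    using f unfolding alternating_def cochains_def by blast
qed (auto simp: alternating_def cochains_def)

text \<open>Polarization: expand the vanishing value with a + b in both slots.\<close>

lemma alternating_swap:
  assumes f: "alternating f" and ij: "i < length xs" "j < length xs" "i \<noteq> j"
  shows "f (xs[i := a, j := b]) = - f (xs[i := b, j := a])"
proof -
  let ?g = "\<lambda>a b. f (xs[i := a, j := b])"
  have diag: "?g c c = 0" for c
  proof (rule alternating_nondistinct[OF f])
    have "xs[i := c, j := c] ! i = xs[i := c, j := c] ! j" using ij by simp
    then show "\<not> distinct (xs[i := c, j := c])"
      using ij by (metis length_list_update nth_eq_iff_index_eq)
  qed
  have right: "?g a (b + c) = ?g a b + ?g a c" for a b c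
    using alternating_add[OF f, of j "xs[i := a]"] ij by simp
  have left: "?g (a + c) b = ?g a b + ?g c b" for a b c
    using alternating_add[OF f, of i "xs[j := b]"] ij by (simp add: list_update_swap)
  have "?g a b + ?g b a = 0"
    using diag[of "a + b"] unfolding left right by (simp add: diag add.commute)
  then show ?thesis by (simp add: eq_neg_iff_add_eq_0)
qed

lemma alternating_swap_Cons: "alternating f \<Longrightarrow> f (a # b # xs) = - f (b # a # xs)"
  using alternating_swap[of f 0 "a # b # xs" 1 a b] by simp

text \<open>The interior product with x.\<close>

definition contraction :: "'l \<Rightarrow> ('l list \<Rightarrow> 'm) \<Rightarrow> 'l list \<Rightarrow> 'm" where
  "contraction x f xs = f (x # xs)"

lemma alternating_contraction:
  assumes "alternating f"
  shows "alternating (contraction y f)"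
  unfolding alternating_def
proof (intro conjI allI impI)
  fix xs :: "'l list" and i assume "i < length xs"
  then show "Vector_Spaces.linear scaleL scaleM (\<lambda>x. contraction y f (xs[i := x]))"
    using alternating_add[OF assms, of "Suc i" "y # xs"]
      alternating_scale[OF assms, of "Suc i" "y # xs"]
    by (intro linearI) (simp_all add: contraction_def)
qed (use assms in \<open>simp add: contraction_def alternating_nondistinct\<close>)

lemma contraction_cochains: "f \<in> cochains (Suc n) \<Longrightarrow> contraction y f \<in> cochains n"
  by (simp add: cochains_iff alternating_contraction) (simp add: contraction_def)

lemma contraction_add:
  "alternating f \<Longrightarrow> contraction (x + y) f = contraction x f + contraction y f"
  using alternating_add[of f 0 "x # xs" for xs] by (auto simp: contraction_def)

lemma contraction_zero: "alternating f \<Longrightarrow> contraction 0 f = 0"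
  using contraction_add[of f 0 0] by simp

lemma nths_Cons_Compl_0: "nths (x # xs) (- {0}) = xs"
  and nths_Cons_Compl_Suc: "nths (x # xs) (- {Suc i}) = x # nths xs (- {i})"
  and nths_Cons_Compl_0_Suc: "nths (x # xs) (- {0, Suc i}) = nths xs (- {i})"
  and nths_Cons_Compl_Suc_Suc: "nths (x # xs) (- {Suc i, Suc j}) = x # nths xs (- {i, j})"
  by (auto simp: nths_Cons nths_all intro!: arg_cong2[where f = nths])

text \<open>The head passes over j entries, each costing a sign. This turns the bracket terms of
  \<open>differential\<close>, which put the bracket in front, into the in-place replacements of a
  Lie derivative.\<close>

lemma alternating_move_head:
  "alternating f \<Longrightarrow> j < length xs \<Longrightarrow>
    f (b # nths xs (- {j})) = (-1) ^ j *\<^sub>M f (xs[j := b])"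
proof (induction xs arbitrary: j f)
  case (Cons y ys)
  show ?case
  proof (cases j)
    case (Suc i)
    have "f (b # y # nths ys (- {i})) = - contraction y f (b # nths ys (- {i}))"
      using alternating_swap_Cons[OF Cons.prems(1), of b y "nths ys (- {i})"]
      by (simp add: contraction_def)
    also have "\<dots> = - ((-1) ^ i *\<^sub>M contraction y f (ys[i := b]))"
      using Cons Suc by (simp add: alternating_contraction)
    finally show ?thesis
      by (simp add: Suc nths_Cons_Compl_Suc contraction_def)
  qed (simp add: nths_Cons_Compl_0)
qed simp

text \<open>The natural action of x on multilinear maps from L to M.\<close>

definition lie_derivative :: "'l \<Rightarrow> ('l list \<Rightarrow> 'm) \<Rightarrow> 'l list \<Rightarrow> 'm" where
  "lie_derivative x f xs = act x (f xs) - (\<Sum>j<length xs. f (xs[j := bracket x (xs ! j)]))"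

lemma lie_derivative_Nil: "lie_derivative x f [] = act x (f [])"
  by (simp add: lie_derivative_def)

lemma lie_derivative_add: "lie_derivative x (f + g) = lie_derivative x f + lie_derivative x g"
  by (auto simp: lie_derivative_def act_add_right sum.distrib)

lemma lie_derivative_diff: "lie_derivative x (f - g) = lie_derivative x f - lie_derivative x g"
  by (auto simp: lie_derivative_def act_diff_right sum_subtractf)

text \<open>The summand j = 0 replaces the head y and is split off. In operator form the commutator
  of \<theta>_x with i_y is i_[x,y], the relation behind all later inductions on the
  arguments.\<close>

lemma contraction_lie_derivative:
  "contraction y (lie_derivative x f) =
    lie_derivative x (contraction y f) - contraction (bracket x y) f"
  by (rule ext) (simp add: lie_derivative_def contraction_def sum.lessThan_Suc_shift algebra_simps
      del: sum.lessThan_Suc)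

lemma alternating_lie_derivative:
  assumes f: "alternating f"
  shows "alternating (lie_derivative x f)"
  unfolding alternating_def
proof (intro conjI allI impI)
  fix xs :: "'l list" and i assume i: "i < length xs"
  \<comment> \<open>This is the j-th summand as a function of the entry u in slot i. For j = i its
    linearity comes from the bracket and f together, otherwise from f alone.\<close>
  define t where "t j u = f (xs[i := u, j := bracket x (xs[i := u] ! j)])" for j u
  have t: "t j (u + v) = t j u + t j v \<and> t j (c *\<^sub>L u) = c *\<^sub>M t j u"
    if "j < length xs" for j u v c
  proof (cases "j = i")
    case True
    then show ?thesis
      using i by (simp add: t_def bracket_add_right bracket_scale_right alternating_add[OF f]
          alternating_scale[OF f])
  next
    case False
    then have "t j u = f ((xs[j := bracket x (xs ! j)])[i := u])" for u
      by (simp add: t_def list_update_swap)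
    then show ?thesis
      using i by (simp add: alternating_add[OF f] alternating_scale[OF f])
  qed
  show "Vector_Spaces.linear scaleL scaleM (\<lambda>u. lie_derivative x f (xs[i := u]))"
  proof (rule linearI)
    have eq: "lie_derivative x f (xs[i := u]) = act x (f (xs[i := u])) - (\<Sum>j<length xs. t j u)" for u
      by (simp add: lie_derivative_def t_def)
    show "lie_derivative x f (xs[i := u + v]) =
        lie_derivative x f (xs[i := u]) + lie_derivative x f (xs[i := v])" for u v
    proof -
      have "(\<Sum>j<length xs. t j (u + v)) = (\<Sum>j<length xs. t j u) + (\<Sum>j<length xs. t j v)"
        using t by (simp flip: sum.distrib)
      then show ?thesis using i by (simp add: eq alternating_add[OF f] act_add_right)
    qed
    show "lie_derivative x f (xs[i := c *\<^sub>L u]) = c *\<^sub>M lie_derivative x f (xs[i := u])" for c u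
    proof -
      have "(\<Sum>j<length xs. t j (c *\<^sub>L u)) = c *\<^sub>M (\<Sum>j<length xs. t j u)"
        using t by (simp add: M.scale_sum_right)
      then show ?thesis
        using i by (simp add: eq alternating_scale[OF f] act_scale_right M.scale_right_diff_distrib)
    qed
  qed
next
  fix xs :: "'l list" assume "\<not> distinct xs"
  then obtain i j where ij: "i < length xs" "j < length xs" "i \<noteq> j" "xs ! i = xs ! j"
    by (auto simp: distinct_conv_nth)
  let ?t = "\<lambda>k. f (xs[k := bracket x (xs ! k)])"
  \<comment> \<open>Changing a slot other than i and j leaves the repeated entry in place, so only
    two summands remain.\<close>
  have "(\<Sum>k<length xs. ?t k) = (\<Sum>k\<in>{i, j}. ?t k)"
  proof (rule sum.mono_neutral_right)
    show "\<forall>k\<in>{..<length xs} - {i, j}. ?t k = 0"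
    proof
      fix k assume "k \<in> {..<length xs} - {i, j}"
      then have "xs[k := bracket x (xs ! k)] ! i = xs[k := bracket x (xs ! k)] ! j"
        using ij(4) by simp
      then have "\<not> distinct (xs[k := bracket x (xs ! k)])"
        using ij(1-3) by (metis length_list_update nth_eq_iff_index_eq)
      then show "?t k = 0" by (rule alternating_nondistinct[OF f])
    qed
  qed (use ij in auto)
  also have "\<dots> = ?t i + ?t j" using ij by simp
  also have "\<dots> = 0"
  proof -
    \<comment> \<open>As the entries i and j agree, rewriting the untouched slot changes nothing.
      The two summands then differ by a swap and cancel.\<close>
    have "xs[i := a, j := xs ! i] = xs[i := a]" "xs[i := xs ! i, j := a] = xs[j := a]" for a
      using ij(3,4) by (metis list_update_id list_update_swap)+
    then show ?thesis
      using alternating_swap[OF f ij(1-3), of "bracket x (xs ! i)" "xs ! i"] ij(4)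
      by (simp add: eq_neg_iff_add_eq_0)
  qed
  finally show "lie_derivative x f xs = 0"
    using alternating_nondistinct[OF f \<open>\<not> distinct xs\<close>]
    by (simp add: lie_derivative_def act_zero_right)
qed

lemma lie_derivative_cochains: "f \<in> cochains n \<Longrightarrow> lie_derivative x f \<in> cochains n"
  by (simp add: cochains_iff alternating_lie_derivative) (simp add: lie_derivative_def act_zero_right)

text \<open>On the empty list this is the module axiom. Otherwise contract with the first argument
  z: the mixed terms are symmetric in x and y and cancel, and the double brackets combine by the
  Jacobi identity.\<close>

lemma lie_derivative_commutator:
  "alternating f \<Longrightarrow>
    lie_derivative x (lie_derivative y f) xs - lie_derivative y (lie_derivative x f) xs =
    lie_derivative (bracket x y) f xs"
proof (induction xs arbitrary: f)
  case Nil
  show ?case by (simp add: lie_derivative_Nil act_bracket)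
next
  case (Cons z zs)
  have eq: "lie_derivative a (lie_derivative b f) (z # zs) =
      (lie_derivative a (lie_derivative b (contraction z f))
      - lie_derivative a (contraction (bracket b z) f)
      - lie_derivative b (contraction (bracket a z) f)
      + contraction (bracket b (bracket a z)) f) zs" for a b
  proof -
    have "contraction z (lie_derivative a (lie_derivative b f)) =
        lie_derivative a (lie_derivative b (contraction z f))
        - lie_derivative a (contraction (bracket b z) f)
        - lie_derivative b (contraction (bracket a z) f)
        + contraction (bracket b (bracket a z)) f"
      by (simp add: contraction_lie_derivative lie_derivative_diff)
    then show ?thesis by (metis contraction_def)
  qed
  have "contraction (bracket x (bracket y z)) f =
      contraction (bracket (bracket x y) z) f + contraction (bracket y (bracket x z)) f"
    by (subst bracket_derivation) (rule contraction_add[OF Cons.prems])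
  moreover have "lie_derivative (bracket x y) f (z # zs) =
      lie_derivative (bracket x y) (contraction z f) zs - contraction (bracket (bracket x y) z) f zs"
    using contraction_lie_derivative[of z "bracket x y" f]
    by (metis contraction_def minus_apply)
  ultimately show ?case
    using Cons.IH[OF alternating_contraction[OF Cons.prems], of z] by (simp add: eq algebra_simps)
qed

section \<open>The differential, Cartan's formula and their compatibility with the Lie
  derivative\<close>

lemma differential_diff: "differential (f - g) = differential f - differential g"
  by (rule ext) (simp add: differential_def act_diff_right M.scale_right_diff_distrib sum_subtractf
      algebra_simps)

lemma differential_Nil: "differential f [] = 0"
  by (simp add: differential_def)

text \<open>Sort the terms by whether x acts or is bracketed: those give the Lie derivative. In the
  others x is a passive argument, and they give the differential of the contraction with the
  opposite sign.\<close>

lemma differential_Cons: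
  assumes f: "alternating f"
  shows "differential f (x # xs) = lie_derivative x f xs - differential (contraction x f) xs"
proof -
  let ?n = "length xs"
  let ?a = "\<Sum>i<?n. (-1) ^ i *\<^sub>M act (xs ! i) (f (x # nths xs (- {i})))"
  let ?b = "\<lambda>j. f (xs[j := bracket x (xs ! j)])"
  let ?c = "\<lambda>j. \<Sum>i<j. (-1) ^ (i + j) *\<^sub>M f (x # bracket (xs ! i) (xs ! j) # nths xs (- {i, j}))"
  \<comment> \<open>The sign (-1)^j from moving the bracket into slot j meets the coefficient
    (-1)^(j+1) and leaves -1.\<close>
  have b: "f (bracket x (xs ! j) # nths xs (- {j})) = (-1) ^ j *\<^sub>M ?b j" if "j < ?n" for j
    using alternating_move_head[OF f that] .
  have sgn: "(-1) ^ j * (-1) ^ j = (1::'k)" for j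
    by (simp flip: power_mult_distrib)
  \<comment> \<open>Both indices shift by one, so their sign is unchanged; the minus comes from
    bringing x back to the front.\<close>
  have c: "f (bracket u v # x # zs) = - f (x # bracket u v # zs)" for u v zs
    by (rule alternating_swap_Cons[OF f])
  have "differential f (x # xs) = act x (f xs) - ?a +
      (\<Sum>j<?n. (-1) ^ Suc j *\<^sub>M f (bracket x (xs ! j) # nths xs (- {j})) +
        (\<Sum>i<j. (-1) ^ (i + j) *\<^sub>M f (bracket (xs ! i) (xs ! j) # x # nths xs (- {i, j}))))"
    by (simp add: differential_def sum.lessThan_Suc_shift nths_Cons_Compl_0 nths_Cons_Compl_Suc
        nths_Cons_Compl_0_Suc nths_Cons_Compl_Suc_Suc sum_negf del: sum.lessThan_Suc)
  also have "\<dots> = act x (f xs) - ?a + (\<Sum>j<?n. - ?b j - ?c j)"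
    by (simp add: b c sgn sum_negf)
  also have "\<dots> = lie_derivative x f xs - (?a + (\<Sum>j<?n. ?c j))"
    by (simp add: lie_derivative_def sum_subtractf sum_negf)
  also have "?a + (\<Sum>j<?n. ?c j) = differential (contraction x f) xs"
    by (simp add: differential_def contraction_def)
  finally show ?thesis .
qed

lemma cartan_formula:
  "alternating f \<Longrightarrow>
    contraction x (differential f) = lie_derivative x f - differential (contraction x f)"
  by (rule ext) (simp add: contraction_def[of x "differential f"] differential_Cons)

text \<open>Contract with the first argument y. Cartan's formula then reduces the claim to the
  commutator of \<theta>_x and \<theta>_y and to the shorter list with i_y f in place of f.\<close>

lemma lie_derivative_differential:
  "alternating f \<Longrightarrow>
    lie_derivative x (differential f) xs = differential (lie_derivative x f) xs"
proof (induction xs arbitrary: f)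
  case Nil
  show ?case by (simp add: lie_derivative_Nil differential_Nil act_zero_right)
next
  case (Cons y ys)
  note f = Cons.prems
  have "lie_derivative x (differential f) (y # ys) =
      (lie_derivative x (contraction y (differential f)) -
        contraction (bracket x y) (differential f)) ys"
    using contraction_lie_derivative[of y x "differential f"] by (metis contraction_def)
  also have "\<dots> = lie_derivative x (lie_derivative y f) ys
      - lie_derivative x (differential (contraction y f)) ys
      - lie_derivative (bracket x y) f ys + differential (contraction (bracket x y) f) ys"
    by (simp add: cartan_formula[OF f] lie_derivative_diff)
  also have "\<dots> = lie_derivative y (lie_derivative x f) ys
      - differential (lie_derivative x (contraction y f)) ys
      + differential (contraction (bracket x y) f) ys"
    using lie_derivative_commutator[OF f, of x y ys] Cons.IH[OF alternating_contraction[OF f], of y]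
    by (simp add: algebra_simps)
  also have "\<dots> = differential (lie_derivative x f) (y # ys)"
    by (simp add: differential_Cons alternating_lie_derivative f contraction_lie_derivative
        differential_diff)
  finally show ?case .
qed

section \<open>Vanishing of cohomology\<close>

text \<open>This makes the commutator lemmas applicable to the Lie derivative as a linear
  operator.\<close>

sublocale maps: vector_space "\<lambda>c (f :: 'l list \<Rightarrow> 'm) xs. c *\<^sub>M f xs"
  by unfold_locales (auto simp: M.scale_right_distrib M.scale_left_distrib)

lemma linear_lie_derivative:
  "Vector_Spaces.linear (\<lambda>c f xs. c *\<^sub>M f xs) (\<lambda>c f xs. c *\<^sub>M f xs) (lie_derivative x)"
  unfolding Vector_Spaces.linear_iff
proof (intro conjI allI)
  show "lie_derivative x (\<lambda>xs. c *\<^sub>M f xs) = (\<lambda>xs. c *\<^sub>M lie_derivative x f xs)" for c f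
    by (rule ext) (simp add: lie_derivative_def act_scale_right M.scale_right_diff_distrib
        M.scale_sum_right)
qed (rule maps.vector_space_axioms lie_derivative_add)+

section \<open>Powers of the Lie derivative and of the action\<close>

lemma alternating_funpow_lie_derivative:
  "alternating f \<Longrightarrow> alternating ((lie_derivative x ^^ k) f)"
  by (induction k) (simp_all add: alternating_lie_derivative)

lemma funpow_lie_derivative_cochains:
  "f \<in> cochains n \<Longrightarrow> (lie_derivative x ^^ k) f \<in> cochains n"
  by (induction k) (simp_all add: lie_derivative_cochains)

lemma funpow_lie_derivative_differential:
  assumes "alternating f"
  shows "(lie_derivative x ^^ k) (differential f) = differential ((lie_derivative x ^^ k) f)"
proof (induction k)
  case (Suc k)
  then show ?case
    using lie_derivative_differential[OF alternating_funpow_lie_derivative[OF assms]] by auto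
qed simp

text \<open>The commutator of \<theta>^q with i_y is the contraction by (ad x)^q y, which is zero.
  So the arguments can be stripped off one by one, down to the empty list, where \<theta> is just
  the action.\<close>

lemma funpow_lie_derivative:
  assumes "prime CHAR('k)" and ad: "\<And>y. (bracket x ^^ (CHAR('k) ^ m)) y = 0"
  shows "alternating f \<Longrightarrow>
    (lie_derivative x ^^ (CHAR('k) ^ m)) f xs = (act x ^^ (CHAR('k) ^ m)) (f xs)"
proof (induction xs arbitrary: f)
  case Nil
  have "(lie_derivative x ^^ k) f [] = (act x ^^ k) (f [])" for k
    by (induction k) (simp_all add: lie_derivative_Nil)
  then show ?case .
next
  case (Cons y ys)
  let ?q = "CHAR('k) ^ m"
  have "(lie_derivative x ^^ ?q) (contraction ((bracket x ^^ 0) y) f)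
      - contraction ((bracket x ^^ 0) y) ((lie_derivative x ^^ ?q) f) =
      contraction ((bracket x ^^ (0 + ?q)) y) f"
    by (rule maps.funpow_char_power_commutator[where S = "\<lambda>k. contraction ((bracket x ^^ k) y)",
          OF assms(1) linear_lie_derivative])
      (simp add: contraction_lie_derivative)
  then have eq: "(lie_derivative x ^^ ?q) (contraction y f) = contraction y ((lie_derivative x ^^ ?q) f)"
    by (simp add: ad contraction_zero[OF Cons.prems])
  have "(lie_derivative x ^^ ?q) f (y # ys) = (lie_derivative x ^^ ?q) (contraction y f) ys"
    unfolding eq contraction_def ..
  also have "\<dots> = (act x ^^ ?q) (contraction y f ys)"
    by (rule Cons.IH[OF alternating_contraction[OF Cons.prems]])
  finally show ?case by (simp only: contraction_def)
qed

text \<open>The same commutator identity among endomorphisms of M: the commutator of the q-th power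
  of x with y is the action of (ad x)^q y.\<close>

lemma funpow_act_central:
  assumes "prime CHAR('k)" and ad: "\<And>y. (bracket x ^^ (CHAR('k) ^ m)) y = 0"
  shows "(act x ^^ (CHAR('k) ^ m)) (act y u) = act y ((act x ^^ (CHAR('k) ^ m)) u)"
proof -
  let ?q = "CHAR('k) ^ m"
  have "(act x ^^ ?q) (act ((bracket x ^^ 0) y) u) - act ((bracket x ^^ 0) y) ((act x ^^ ?q) u) =
      act ((bracket x ^^ (0 + ?q)) y) u"
    by (rule M.funpow_char_power_commutator[OF assms(1) act_linear_right]) (simp add: act_bracket)
  then show ?thesis by (simp add: ad act_zero_left)
qed

text \<open>For large N the module is the direct sum of the image and the kernel of
  \<open>\<phi> ^^ N\<close>, both submodules. The image is nonzero as \<open>\<phi>\<close> is not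
  nilpotent, so indecomposability kills the kernel.\<close>

lemma fitting_bij_endomorphism:
  assumes "finite_dimensional scaleM" indecomposable
    and lin: "Vector_Spaces.linear scaleM scaleM \<phi>"
    and act: "\<And>x u. \<phi> (act x u) = act x (\<phi> u)"
    and "\<not> nilpotent_map \<phi>"
  shows "bij \<phi>"
proof -
  obtain B where "finite_dimensional_vector_space scaleM B"
    using assms(1) unfolding finite_dimensional_def by blast
  then interpret fd: finite_dimensional_vector_space scaleM B .
  obtain N where N: "0 < N" "range (\<phi> ^^ (N + N)) = range (\<phi> ^^ N)"
    "{v. (\<phi> ^^ (N + N)) v = 0} = {v. (\<phi> ^^ N) v = 0}"
    using fd.funpow_stable[OF lin] by blast
  define \<psi> where "\<psi> = \<phi> ^^ N"
  have \<psi>\<psi>: "(\<phi> ^^ (N + N)) v = \<psi> (\<psi> v)" for v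
    by (simp add: \<psi>_def funpow_add)
  interpret \<psi>: Vector_Spaces.linear scaleM scaleM \<psi>
    unfolding \<psi>_def by (rule linear_funpow[OF M.vector_space_axioms lin])
  have "(\<phi> ^^ k) (act x u) = act x ((\<phi> ^^ k) u)" for k x u
    by (induction k) (simp_all add: act)
  then have \<psi>_act: "\<psi> (act x u) = act x (\<psi> u)" for x u
    by (simp add: \<psi>_def)
  let ?U = "range \<psi>" and ?V = "{v. \<psi> v = 0}"
  have "submodule ?U"
    unfolding submodule_def
    using \<psi>.subspace_image[OF M.subspace_UNIV] by (auto simp flip: \<psi>_act)
  moreover have "submodule ?V"
    unfolding submodule_def using \<psi>.subspace_kernel by (auto simp: \<psi>_act act_zero_right)
  moreover have "?U \<inter> ?V = {0}"
  proof -
    have "\<psi> v = 0" if "\<psi> (\<psi> v) = 0" for v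
      using N(3) that by (auto simp: \<psi>\<psi> set_eq_iff \<psi>_def)
    moreover have "0 \<in> ?U" by (metis \<psi>.zero rangeI)
    ultimately show ?thesis by auto
  qed
  moreover have "{u + v | u v. u \<in> ?U \<and> v \<in> ?V} = UNIV"
  proof -
    have "\<exists>u v. w = u + v \<and> u \<in> ?U \<and> v \<in> ?V" for w
    proof -
      \<comment> \<open>Since \<open>\<psi>\<close> and its square have the same image, some
        \<open>\<psi> w'\<close> differs from w by an element of the kernel.\<close>
      have "\<psi> w \<in> range (\<phi> ^^ (N + N))" using N(2) by (simp add: \<psi>_def)
      then obtain w' where "\<psi> w = \<psi> (\<psi> w')" by (auto simp: \<psi>\<psi>)
      then have "w - \<psi> w' \<in> ?V" by (simp add: \<psi>.diff)
      then show ?thesis by (intro exI[of _ "\<psi> w'"] exI[of _ "w - \<psi> w'"]) auto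
    qed
    then show ?thesis by blast
  qed
  ultimately have "?U = {0} \<or> ?V = {0}"
    using assms(2) unfolding indecomposable_def by blast
  moreover have "?U \<noteq> {0}"
    using assms(5) unfolding nilpotent_map_def \<psi>_def by (metis (no_types) ext rangeI singletonD)
  ultimately have V: "?V = {0}" by blast
  have U: "?U = UNIV"
  proof -
    have "w \<in> ?U" for w
    proof -
      have "\<psi> w \<in> range (\<phi> ^^ (N + N))" using N(2) by (simp add: \<psi>_def)
      then obtain w' where "\<psi> w = \<psi> (\<psi> w')" by (auto simp: \<psi>\<psi>)
      then have "w - \<psi> w' \<in> ?V" by (simp add: \<psi>.diff)
      then show ?thesis using V by auto
    qed
    then show ?thesis by blast
  qed
  \<comment> \<open>Splitting one factor off \<open>\<psi>\<close> on the right gives injectivity of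
    \<open>\<phi>\<close>, on the left surjectivity.\<close>
  obtain n where n: "N = Suc n" using N(1) gr0_implies_Suc by blast
  have "inj (\<phi> ^^ n \<circ> \<phi>)"
    using V by (simp only: \<psi>.inj_iff_eq_0 flip: funpow_Suc_right n \<psi>_def) blast
  then have "inj \<phi>" by (rule inj_on_imageI2)
  moreover have "surj \<phi>"
  proof -
    have "\<psi> v = \<phi> ((\<phi> ^^ n) v)" for v by (simp add: \<psi>_def n)
    then show ?thesis using U by (metis surj_def)
  qed
  ultimately show ?thesis by (rule bijI)
qed

section \<open>Coboundaries and the triviality of the cohomology\<close>

lemma zero_cochain: "(\<lambda>_. 0) \<in> cochains n"
  by (simp add: cochains_def linearI)

lemma differential_zero: "differential (\<lambda>_. 0) = (\<lambda>_. 0)"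
  by (rule ext) (simp add: differential_def act_zero_right)

lemma coboundaries_diff:
  assumes "f \<in> coboundaries n" "g \<in> coboundaries n"
  shows "f - g \<in> coboundaries n"
proof (cases n)
  case 0
  then have "f = (\<lambda>_. 0)" "g = (\<lambda>_. 0)" using assms by (simp_all add: coboundaries_def)
  then have "f - g = (\<lambda>_. 0)" by (simp add: fun_eq_iff)
  then show ?thesis using 0 by (simp add: coboundaries_def)
next
  case (Suc m)
  obtain a b where ab: "a \<in> cochains m" "b \<in> cochains m" "f = differential a" "g = differential b"
    using assms Suc by (auto simp: coboundaries_def)
  have "alternating (a - b)"
    unfolding alternating_def
  proof (intro conjI allI impI)
    fix xs :: "'l list" and i assume "i < length xs"
    then show "Vector_Spaces.linear scaleL scaleM (\<lambda>x. (a - b) (xs[i := x]))"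
      using ab(1,2)
      by (intro linearI)
        (simp_all add: cochains_iff alternating_add alternating_scale M.scale_right_diff_distrib)
  qed (use ab(1,2) in \<open>simp add: cochains_iff alternating_nondistinct\<close>)
  then have "a - b \<in> cochains m" using ab(1,2) by (simp add: cochains_iff)
  then show ?thesis
    unfolding ab(3,4) differential_diff[symmetric] by (simp add: Suc coboundaries_def)
qed

lemma cohomology_trivialI:
  assumes "cocycles n \<subseteq> coboundaries n"
  shows "cohomology n = {cohomology_class n (\<lambda>_. 0)}"
proof -
  have z: "(\<lambda>_. 0) \<in> cocycles n"
    by (simp add: cocycles_def zero_cochain differential_zero)
  have "cohomology_class n f = coboundaries n" if f: "f \<in> coboundaries n" for f
  proof -
    have "g \<in> coboundaries n \<Longrightarrow> \<exists>b\<in>coboundaries n. g = (\<lambda>xs. f xs + b xs)" for g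
      using coboundaries_diff[OF _ f, of g] by (intro bexI[of _ "g - f"]) auto
    moreover have "(\<lambda>xs. f xs + b xs) \<in> coboundaries n" if b: "b \<in> coboundaries n" for b
    proof -
      \<comment> \<open>A sum is written as a double difference to use closure under differences;
        zero is a coboundary because it is a cocycle.\<close>
      have "f - ((\<lambda>_. 0) - b) \<in> coboundaries n"
        using coboundaries_diff f b z assms by blast
      moreover have "f - ((\<lambda>_. 0) - b) = (\<lambda>xs. f xs + b xs)" by auto
      ultimately show ?thesis by simp
    qed
    ultimately show ?thesis unfolding cohomology_class_def by blast
  qed
  then have "cohomology_class n f = cohomology_class n (\<lambda>_. 0)" if "f \<in> cocycles n" for f
    using that z assms by blast
  then have "cohomology n = (\<lambda>_. cohomology_class n (\<lambda>_. 0)) ` cocycles n"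
    unfolding cohomology_def by (intro image_cong refl)
  then show ?thesis using image_constant[OF z] by simp
qed

lemma differential_commute:
  assumes lin: "Vector_Spaces.linear scaleM scaleM \<phi>"
    and act: "\<And>x u. \<phi> (act x u) = act x (\<phi> u)"
  shows "differential (\<lambda>xs. \<phi> (f xs)) xs = \<phi> (differential f xs)"
proof -
  interpret Vector_Spaces.linear scaleM scaleM \<phi> by fact
  show ?thesis by (simp add: differential_def add sum scale act)
qed

lemma cohomology_vanishes:
  assumes "prime CHAR('k)" "finite_dimensional scaleM" indecomposable
    and ad: "\<And>k y. N \<le> k \<Longrightarrow> (bracket x ^^ k) y = 0"
    and x: "\<not> nilpotent_map (act x)"
  shows "cocycles n \<subseteq> coboundaries n"
proof
  fix f assume "f \<in> cocycles n"
  then have f: "f \<in> cochains n" and df: "differential f = (\<lambda>_. 0)"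
    by (auto simp: cocycles_def)
  then have alt: "alternating f" by (simp add: cochains_iff)
  have p: "1 < CHAR('k)" using assms(1) prime_gt_1_nat by blast
  \<comment> \<open>This power of the characteristic exceeds N, so it also annihilates ad x.\<close>
  let ?q = "CHAR('k) ^ N"
  have ad': "(bracket x ^^ ?q) y = 0" for y
    using power_gt_expt[of "CHAR('k)" N] p by (intro ad) simp
  define \<phi> where "\<phi> = act x ^^ ?q"
  have lin: "Vector_Spaces.linear scaleM scaleM \<phi>"
    unfolding \<phi>_def by (rule linear_funpow[OF M.vector_space_axioms act_linear_right])
  have act: "\<phi> (act y u) = act y (\<phi> u)" for y u
    unfolding \<phi>_def using funpow_act_central[OF assms(1) ad'] .
  \<comment> \<open>A vanishing power of \<open>\<phi>\<close> would be a vanishing power of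
    \<open>act x\<close>.\<close>
  have "\<not> nilpotent_map \<phi>"
    using x unfolding nilpotent_map_def \<phi>_def by (auto simp: funpow_mult)
  then have bij: "bij \<phi>"
    using fitting_bij_endomorphism assms(2,3) lin act by blast
  have lin': "Vector_Spaces.linear scaleM scaleM (inv \<phi>)"
    using lin bij unfolding Vector_Spaces.linear_iff by (metis bij_inv_eq_iff)
  have inv0: "inv \<phi> 0 = 0"
    using lin' by (metis M.scale_zero_left Vector_Spaces.linear_iff)
  have act': "inv \<phi> (act y u) = act y (inv \<phi> u)" for y u
    using bij act by (metis bij_inv_eq_iff)
  have \<phi>f: "(lie_derivative x ^^ ?q) f = (\<lambda>xs. \<phi> (f xs))"
    unfolding \<phi>_def using funpow_lie_derivative[OF assms(1) ad' alt] by blast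
  have cartan: "lie_derivative x f = differential (contraction x f)"
    using cartan_formula[OF alt, of x] df by (auto simp: fun_eq_iff contraction_def)
  \<comment> \<open>One of the q Lie derivatives is spent on Cartan's formula; the other q - 1 pass
    through the differential.\<close>
  define h where "h = (lie_derivative x ^^ (?q - 1)) (contraction x f)"
  have "(lie_derivative x ^^ ?q) f = (lie_derivative x ^^ (?q - 1)) (lie_derivative x f)"
    using p by (metis comp_apply funpow_Suc_right Suc_diff_1 zero_less_power less_trans zero_less_one)
  then have "(\<lambda>xs. \<phi> (f xs)) = differential h"
    by (simp add: \<phi>f cartan h_def funpow_lie_derivative_differential alternating_contraction alt)
  then have "f xs = inv \<phi> (differential h xs)" for xs
    using bij by (metis bij_inv_eq_iff)
  then have fh: "f = differential (\<lambda>xs. inv \<phi> (h xs))"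
    by (auto simp: differential_commute[OF lin' act'])
  show "f \<in> coboundaries n"
  proof (cases n)
    \<comment> \<open>A 0-cochain vanishes on nonempty lists, so its contraction and h are zero.
      Then f itself is zero, the only coboundary in degree 0.\<close>
    case 0
    then have "contraction x f = (\<lambda>_. 0)"
      using f by (auto simp: cochains_iff contraction_def)
    moreover have "(lie_derivative x ^^ k) (\<lambda>_. 0) = (\<lambda>_. 0)" for k
      by (induction k) (auto simp: lie_derivative_def act_zero_right)
    ultimately have "differential h = (\<lambda>_. 0)"
      by (simp add: h_def differential_zero)
    then show ?thesis
      using 0 \<open>\<And>xs. f xs = inv \<phi> (differential h xs)\<close> inv0
      by (auto simp: coboundaries_def)
  next
    case (Suc m)
    have "h \<in> cochains m"
      unfolding h_def using f Suc
      by (intro funpow_lie_derivative_cochains contraction_cochains) simp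
    then have "(\<lambda>xs. inv \<phi> (h xs)) \<in> cochains m"
      using Vector_Spaces.linear_compose[OF _ lin', of scaleL "\<lambda>x. h (xs[i := x])" for xs i]
      by (simp add: cochains_def inv0 o_def)
    then show ?thesis
      using Suc fh by (auto simp: coboundaries_def)
  qed
qed

end

theorem corollary3p4:
  fixes scaleL :: "'k::field \<Rightarrow> 'l::ab_group_add \<Rightarrow> 'l"
    and bracket :: "'l \<Rightarrow> 'l \<Rightarrow> 'l"
    and G :: "int \<Rightarrow> 'l set"
    and scaleM :: "'k \<Rightarrow> 'm::ab_group_add \<Rightarrow> 'm"
    and act :: "'l \<Rightarrow> 'm \<Rightarrow> 'm"
  assumes "prime CHAR('k)"
    and "graded_lie_algebra scaleL bracket G"
    and "finite_dimensional scaleL"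
    and "lie_module scaleL bracket scaleM act"
    and "finite_dimensional scaleM"
    and "lie_module.indecomposable scaleM act"
    and "\<exists>x \<in> graded_lie_algebra.positive_part scaleL G \<union> graded_lie_algebra.negative_part scaleL G.
           \<not> nilpotent_map (act x)"
  shows "\<forall>n. lie_module.cohomology scaleL bracket scaleM act n
           = {lie_module.cohomology_class scaleL bracket scaleM act n (\<lambda>_. 0)}"
proof
  fix n
  interpret L: graded_lie_algebra scaleL bracket G by fact
  interpret lie_module scaleL bracket scaleM act by fact
  obtain x where x: "x \<in> L.positive_part \<union> L.negative_part" "\<not> nilpotent_map (act x)"
    using assms(7) by blast
  obtain N where "\<And>k y. N \<le> k \<Longrightarrow> (bracket x ^^ k) y = 0"
    using L.ad_nilpotent[OF assms(3) x(1)] by blast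
  then show "cohomology n = {cohomology_class n (\<lambda>_. 0)}"
    by (rule cohomology_trivialI[OF cohomology_vanishes[OF assms(1,5,6) _ x(2)]])
qed

end
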